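(* Let $(M,[g])$ and $(N,[h])$ be two connected conformal pseudo-Riemannian manifolds of the same signature $(p,q)$, $p+q\geq 3$, and let $(f_k)$ be a sequence of smooth conformal immersions from $M$ to $N$ converging uniformly on compact subsets of $M$ to a map $f\in\mathcal C^0(M,N)$. Let $x\in M$ and let $U_x$ be a neighbourhood of $x$. Suppose that $\{x\}=F_0^{loc}(x)\subsetneq F_1^{loc}(x)\subsetneq\dots\subsetneq F_{s-1}^{loc}(x)\subsetneq U_x$ are submanifolds and $\mu_1(k),\dots,\mu_s(k)$ are sequences of positive reals such that $(F_j^{loc}(x),\mu_j)$ is a dynamical stratification of $U_x$ for $(f_k)$. Suppose that $\{x\}=H_0^{loc}(x)\subsetneq H_1^{loc}(x)\subsetneq\dots\subsetneq H_{r-1}^{loc}(x)\subsetneq U_x$ is another family of submanifolds and $\eta_1(k),\dots,\eta_r(k)$ are other sequences of positive reals such that $(H_j^{loc}(x),\eta_j)$ is also a dynamical stratification of $U_x$ for $(f_k)$. Then $r=s$, $H_j^{loc}(x)=F_j^{loc}(x)$ for all $j=0,\dots,s-1$, and $\eta_j(k)=\Theta(\mu_j(k))$ for all $j=1,\dots,s$.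
   Context: $N$ is equipped with an auxiliary Riemannian metric and the associated distance $d$. For sequences of nonnegative reals, $a_k=\Theta(b_k)$ means there are $C_1,C_2>0$ with $C_1b_k\le a_k\le C_2b_k$ for $k$ large; $a_k=O(b_k)$ means there is $C>0$ with $a_k\le Cb_k$ for $k$ large. Terminology (for this statement): submanifolds $\{x\}=F_0\subsetneq F_1\subsetneq\dots\subsetneq F_{s-1}\subsetneq U_x$ ($s\ge1$) together with sequences $\mu_1(k),\dots,\mu_s(k)$ of positive reals, with $\mu_j(k)=O(\mu_{j+1}(k))$ for $1\le j\le s-1$, form a dynamical stratification of $U_x$ for $(f_k)$ if: (a) a point $y$ belongs to $U_x\setminus F_{s-1}$ if and only if for every sequence $(y_k)$ of $U_x$ converging to $y$, $d(f_k(x),f_k(y_k))=\Theta(\mu_s(k))$; (b) for $j=1,\dots,s-1$, a point $y$ belongs to $F_j\setminus F_{j-1}$ if and only if both: (i) for every sequence $(y_k)$ of $U_x$ converging to $y$, $\mu_j(k)=O(d(f_k(x),f_k(y_k)))$; (ii) there exists a sequence $(y_k)$ of $U_x$ converging to $y$ with $d(f_k(x),f_k(y_k))=\Theta(\mu_j(k))$. *)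

theory Defs
  imports "HOL-Analysis.Analysis" "HOL-Library.Landau_Symbols"
begin

section \<open>Smooth maps between open subsets of normed spaces\<close>

primrec times_differentiable_on ::
    "nat \<Rightarrow> 'a::real_normed_vector set \<Rightarrow> ('a \<Rightarrow> 'b::real_normed_vector) \<Rightarrow> bool" where
  "times_differentiable_on 0 S f \<longleftrightarrow> continuous_on S f"
| "times_differentiable_on (Suc k) S f \<longleftrightarrow>
     (\<forall>x\<in>S. f differentiable (at x)) \<and>
     (\<forall>v. times_differentiable_on k S (\<lambda>x. frechet_derivative f (at x) v))"

text \<open>Meant for finite-dimensional domains and open \<open>S\<close>: all iterated directional derivatives exist
  and are continuous.\<close>

definition smooth_on ::
    "'a::real_normed_vector set \<Rightarrow> ('a \<Rightarrow> 'b::real_normed_vector) \<Rightarrow> bool" where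
  "smooth_on S f \<longleftrightarrow> (\<forall>k. times_differentiable_on k S f)"


section \<open>Smooth manifolds\<close>

text \<open>A chart is a pair \<open>(U, \<phi>)\<close> of a domain and a coordinate map. A manifold is a topology with an
  atlas, which need not be maximal; its dimension is \<open>CARD('n)\<close>.\<close>

type_synonym ('a, 'n) chart = "'a set \<times> ('a \<Rightarrow> real ^ 'n)"

definition chart_on :: "'a topology \<Rightarrow> ('a, 'n::finite) chart \<Rightarrow> bool" where
  "chart_on X c \<longleftrightarrow>
     openin X (fst c) \<and> open (snd c ` fst c) \<and>
     homeomorphic_map (subtopology X (fst c)) (top_of_set (snd c ` fst c)) (snd c)"

definition chart_inv :: "('a, 'n) chart \<Rightarrow> real ^ 'n \<Rightarrow> 'a" where
  "chart_inv c = inv_into (fst c) (snd c)"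

text \<open>The coordinate expression of a map \<open>f\<close>, the open set on which it is meaningful (for continuous
  \<open>f\<close>), and the coordinate expression of the differential of \<open>f\<close> at \<open>x\<close>.\<close>

definition local_rep ::
    "('a, 'n) chart \<Rightarrow> ('b, 'm) chart \<Rightarrow> ('a \<Rightarrow> 'b) \<Rightarrow> real ^ 'n \<Rightarrow> real ^ 'm" where
  "local_rep c c' f = snd c' \<circ> f \<circ> chart_inv c"

definition local_dom :: "('a, 'n) chart \<Rightarrow> ('b, 'm) chart \<Rightarrow> ('a \<Rightarrow> 'b) \<Rightarrow> (real ^ 'n) set" where
  "local_dom c c' f = snd c ` {x \<in> fst c. f x \<in> fst c'}"

definition local_diff ::
    "('a, 'n::finite) chart \<Rightarrow> ('b, 'm::finite) chart \<Rightarrow> ('a \<Rightarrow> 'b) \<Rightarrow> 'a \<Rightarrow> real ^ 'n \<Rightarrow> real ^ 'm" where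
  "local_diff c c' f x = frechet_derivative (local_rep c c' f) (at (snd c x))"

definition smoothly_compatible :: "('a, 'n::finite) chart \<Rightarrow> ('a, 'n) chart \<Rightarrow> bool" where
  "smoothly_compatible c c' \<longleftrightarrow>
     smooth_on (local_dom c c' id) (local_rep c c' id) \<and>
     smooth_on (local_dom c' c id) (local_rep c' c id)"

definition smooth_manifold :: "'a topology \<Rightarrow> ('a, 'n::finite) chart set \<Rightarrow> bool" where
  "smooth_manifold X A \<longleftrightarrow>
     Hausdorff_space X \<and> second_countable X \<and>
     (\<forall>c\<in>A. chart_on X c) \<and> (\<Union>c\<in>A. fst c) = topspace X \<and>
     (\<forall>c\<in>A. \<forall>c'\<in>A. smoothly_compatible c c')"

definition maximal_atlas ::
    "'a topology \<Rightarrow> ('a, 'n::finite) chart set \<Rightarrow> ('a, 'n) chart set" where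
  "maximal_atlas X A = {c. chart_on X c \<and> (\<forall>c'\<in>A. smoothly_compatible c c')}"

text \<open>Embedded submanifolds (without boundary, of constant dimension), by slice charts.\<close>

definition submanifold :: "'a topology \<Rightarrow> ('a, 'n::finite) chart set \<Rightarrow> 'a set \<Rightarrow> bool" where
  "submanifold X A S \<longleftrightarrow> S \<subseteq> topspace X \<and>
     (\<exists>m. \<forall>x\<in>S. \<exists>c\<in>maximal_atlas X A. x \<in> fst c \<and>
        (\<exists>L. subspace L \<and> dim L = m \<and> snd c ` (S \<inter> fst c) = L \<inter> snd c ` fst c))"

definition smooth_map ::
    "'a topology \<Rightarrow> ('a, 'n::finite) chart set \<Rightarrow> 'b topology \<Rightarrow> ('b, 'm::finite) chart set \<Rightarrow>
     ('a \<Rightarrow> 'b) \<Rightarrow> bool" where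
  "smooth_map X A Y B f \<longleftrightarrow> continuous_map X Y f \<and>
     (\<forall>c\<in>A. \<forall>c'\<in>B. smooth_on (local_dom c c' f) (local_rep c c' f))"

definition smooth_immersion ::
    "'a topology \<Rightarrow> ('a, 'n::finite) chart set \<Rightarrow> 'b topology \<Rightarrow> ('b, 'm::finite) chart set \<Rightarrow>
     ('a \<Rightarrow> 'b) \<Rightarrow> bool" where
  "smooth_immersion X A Y B f \<longleftrightarrow> smooth_map X A Y B f \<and>
     (\<forall>c\<in>A. \<forall>c'\<in>B. \<forall>x\<in>fst c. f x \<in> fst c' \<longrightarrow> inj (local_diff c c' f x))"

definition smooth_real_function ::
    "('a, 'n::finite) chart set \<Rightarrow> ('a \<Rightarrow> real) \<Rightarrow> bool" where
  "smooth_real_function A u \<longleftrightarrow> (\<forall>c\<in>A. smooth_on (snd c ` fst c) (u \<circ> chart_inv c))"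


section \<open>Pseudo-Riemannian metrics and conformal structures\<close>

text \<open>\<open>p\<close> is the number of negative and \<open>q\<close> the number of positive directions.\<close>

definition has_signature :: "(real ^ 'n \<Rightarrow> real ^ 'n \<Rightarrow> real) \<Rightarrow> nat \<Rightarrow> nat \<Rightarrow> bool" where
  "has_signature b p q \<longleftrightarrow>
     (\<exists>E. independent E \<and> span E = UNIV \<and>
        (\<forall>u\<in>E. \<forall>v\<in>E. u \<noteq> v \<longrightarrow> b u v = 0) \<and> (\<forall>u\<in>E. b u u \<noteq> 0) \<and>
        card {u\<in>E. b u u < 0} = p \<and> card {u\<in>E. b u u > 0} = q)"

text \<open>A covariant 2-tensor field is given by its coordinate expressions: \<open>g c x u v\<close> is the value at
  \<open>x\<close> on the two tangent vectors with components \<open>u\<close> and \<open>v\<close> in the chart \<open>c\<close>. Only the values for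
  charts \<open>c\<close> of the atlas and \<open>x\<close> in the domain of \<open>c\<close> are meaningful.\<close>

type_synonym ('a, 'n) tensor2 = "('a, 'n) chart \<Rightarrow> 'a \<Rightarrow> real ^ 'n \<Rightarrow> real ^ 'n \<Rightarrow> real"

definition pseudo_riemannian_metric ::
    "('a, 'n::finite) chart set \<Rightarrow> nat \<Rightarrow> nat \<Rightarrow> ('a, 'n) tensor2 \<Rightarrow> bool" where
  "pseudo_riemannian_metric A p q g \<longleftrightarrow>
     (\<forall>c\<in>A. \<forall>x\<in>fst c.
        bilinear (g c x) \<and> (\<forall>u v. g c x u v = g c x v u) \<and> has_signature (g c x) p q) \<and>
     (\<forall>c\<in>A. \<forall>c'\<in>A. \<forall>x\<in>fst c \<inter> fst c'. \<forall>u v.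
        g c x u v = g c' x (local_diff c c' id x u) (local_diff c c' id x v)) \<and>
     (\<forall>c\<in>A. \<forall>u v. smooth_on (snd c ` fst c) (\<lambda>z. g c (chart_inv c z) u v))"

abbreviation riemannian_metric :: "('a, 'n::finite) chart set \<Rightarrow> ('a, 'n) tensor2 \<Rightarrow> bool" where
  "riemannian_metric A \<equiv> pseudo_riemannian_metric A 0 CARD('n)"

definition conformal_class ::
    "('a, 'n::finite) chart set \<Rightarrow> nat \<Rightarrow> nat \<Rightarrow> ('a, 'n) tensor2 \<Rightarrow> ('a, 'n) tensor2 set" where
  "conformal_class A p q g =
     {g'. pseudo_riemannian_metric A p q g' \<and>
        (\<exists>\<sigma>. smooth_real_function A \<sigma> \<and>
           (\<forall>c\<in>A. \<forall>x\<in>fst c. \<sigma> x > 0 \<and> (\<forall>u v. g' c x u v = \<sigma> x * g c x u v)))}"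

definition is_pullback ::
    "('a, 'n::finite) chart set \<Rightarrow> ('b, 'm::finite) chart set \<Rightarrow> ('a \<Rightarrow> 'b) \<Rightarrow>
     ('b, 'm) tensor2 \<Rightarrow> ('a, 'n) tensor2 \<Rightarrow> bool" where
  "is_pullback A B f h g \<longleftrightarrow>
     (\<forall>c\<in>A. \<forall>c'\<in>B. \<forall>x\<in>fst c. f x \<in> fst c' \<longrightarrow>
        (\<forall>u v. g c x u v = h c' (f x) (local_diff c c' f x u) (local_diff c c' f x v)))"

text \<open>\<open>C\<close> and \<open>D\<close> are conformal classes of metrics.\<close>

definition conformal_immersion ::
    "'a topology \<Rightarrow> ('a, 'n::finite) chart set \<Rightarrow> ('a, 'n) tensor2 set \<Rightarrow>
     'b topology \<Rightarrow> ('b, 'm::finite) chart set \<Rightarrow> ('b, 'm) tensor2 set \<Rightarrow> ('a \<Rightarrow> 'b) \<Rightarrow> bool" where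
  "conformal_immersion X A C Y B D f \<longleftrightarrow>
     smooth_immersion X A Y B f \<and> (\<forall>h\<in>D. \<exists>g\<in>C. is_pullback A B f h g)"


section \<open>Riemannian distance\<close>

definition C1_curve ::
    "'a topology \<Rightarrow> ('a, 'n::finite) chart set \<Rightarrow> real \<Rightarrow> real \<Rightarrow> (real \<Rightarrow> 'a) \<Rightarrow> bool" where
  "C1_curve X A a b \<gamma> \<longleftrightarrow> continuous_map (top_of_set {a..b}) X \<gamma> \<and>
     (\<forall>c\<in>A. \<exists>D. continuous_on {t\<in>{a..b}. \<gamma> t \<in> fst c} D \<and>
        (\<forall>t\<in>{a..b}. \<gamma> t \<in> fst c \<longrightarrow>
           ((snd c \<circ> \<gamma>) has_vector_derivative D t) (at t within {a..b})))"

definition piecewise_C1_curve ::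
    "'a topology \<Rightarrow> ('a, 'n::finite) chart set \<Rightarrow> (real \<Rightarrow> 'a) \<Rightarrow> bool" where
  "piecewise_C1_curve X A \<gamma> \<longleftrightarrow>
     (\<exists>m \<tau>. \<tau> 0 = 0 \<and> \<tau> m = 1 \<and>
        (\<forall>i<m. \<tau> i < \<tau> (Suc i) \<and> C1_curve X A (\<tau> i) (\<tau> (Suc i)) \<gamma>))"

text \<open>The value does not depend on the chosen chart. At the finitely many break points of a
  piecewise \<open>C\<^sup>1\<close> curve it may be meaningless, which does not affect the length.\<close>

definition curve_speed ::
    "('a, 'n::finite) chart set \<Rightarrow> ('a, 'n) tensor2 \<Rightarrow> (real \<Rightarrow> 'a) \<Rightarrow> real \<Rightarrow> real" where
  "curve_speed A \<rho> \<gamma> t =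
     (let c = (SOME c. c \<in> A \<and> \<gamma> t \<in> fst c);
          v = vector_derivative (snd c \<circ> \<gamma>) (at t within {0..1})
      in sqrt (\<rho> c (\<gamma> t) v v))"

definition curve_length ::
    "('a, 'n::finite) chart set \<Rightarrow> ('a, 'n) tensor2 \<Rightarrow> (real \<Rightarrow> 'a) \<Rightarrow> real" where
  "curve_length A \<rho> \<gamma> = integral {0..1} (curve_speed A \<rho> \<gamma>)"

definition riemannian_dist ::
    "'a topology \<Rightarrow> ('a, 'n::finite) chart set \<Rightarrow> ('a, 'n) tensor2 \<Rightarrow> 'a \<Rightarrow> 'a \<Rightarrow> real" where
  "riemannian_dist X A \<rho> x y =
     Inf {curve_length A \<rho> \<gamma> |\<gamma>. piecewise_C1_curve X A \<gamma> \<and> \<gamma> 0 = x \<and> \<gamma> 1 = y}"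


section \<open>Sequences of maps and dynamical stratifications\<close>

definition converges_uniformly_on_compacts ::
    "'a topology \<Rightarrow> ('b \<Rightarrow> 'b \<Rightarrow> real) \<Rightarrow> (nat \<Rightarrow> 'a \<Rightarrow> 'b) \<Rightarrow> ('a \<Rightarrow> 'b) \<Rightarrow> bool" where
  "converges_uniformly_on_compacts X d f f_lim \<longleftrightarrow>
     (\<forall>K. compactin X K \<longrightarrow>
        (\<forall>\<epsilon>>0. \<forall>\<^sub>F k in sequentially. \<forall>x\<in>K. d (f k x) (f_lim x) < \<epsilon>))"

definition sequence_tending_to :: "'a topology \<Rightarrow> 'a set \<Rightarrow> 'a \<Rightarrow> (nat \<Rightarrow> 'a) \<Rightarrow> bool" where
  "sequence_tending_to X U y ys \<longleftrightarrow> range ys \<subseteq> U \<and> limitin X ys y sequentially"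

text \<open>Only \<open>F 0, \<dots>, F (s - 1)\<close> and \<open>\<mu> 1, \<dots>, \<mu> s\<close> are relevant, where \<open>\<mu> j\<close> is the sequence
  \<open>k \<mapsto> \<mu>\<^sub>j(k)\<close>.\<close>

definition dynamical_stratification ::
    "'a topology \<Rightarrow> ('a, 'n::finite) chart set \<Rightarrow> ('b \<Rightarrow> 'b \<Rightarrow> real) \<Rightarrow> (nat \<Rightarrow> 'a \<Rightarrow> 'b) \<Rightarrow>
     'a \<Rightarrow> 'a set \<Rightarrow> nat \<Rightarrow> (nat \<Rightarrow> 'a set) \<Rightarrow> (nat \<Rightarrow> nat \<Rightarrow> real) \<Rightarrow> bool" where
  "dynamical_stratification X A d f x U s F \<mu> \<longleftrightarrow>
     s \<ge> 1 \<and> F 0 = {x} \<and>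
     (\<forall>j<s. submanifold X A (F j)) \<and>
     (\<forall>j. Suc j < s \<longrightarrow> F j \<subset> F (Suc j)) \<and> F (s - 1) \<subset> U \<and>
     (\<forall>j\<in>{1..s}. \<forall>k. \<mu> j k > 0) \<and>
     (\<forall>j\<in>{1..<s}. \<mu> j \<in> O(\<mu> (Suc j))) \<and>
     (\<forall>y\<in>U. y \<in> U - F (s - 1) \<longleftrightarrow>
        (\<forall>ys. sequence_tending_to X U y ys \<longrightarrow> (\<lambda>k. d (f k x) (f k (ys k))) \<in> \<Theta>(\<mu> s))) \<and>
     (\<forall>j\<in>{1..<s}. \<forall>y\<in>U. y \<in> F j - F (j - 1) \<longleftrightarrow>
        (\<forall>ys. sequence_tending_to X U y ys \<longrightarrow> \<mu> j \<in> O(\<lambda>k. d (f k x) (f k (ys k)))) \<and>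
        (\<exists>ys. sequence_tending_to X U y ys \<and> (\<lambda>k. d (f k x) (f k (ys k))) \<in> \<Theta>(\<mu> j)))"

end

theory Submission
  imports Defs
begin

text \<open>
  Each point \<open>y\<close> carries the family of growth sequences \<open>k \<mapsto> d (f k x) (f k (ys k))\<close>, one for every
  sequence \<open>ys\<close> of \<open>U\<close> tending to \<open>y\<close>. The point of the proof is that, for \<open>y \<noteq> x\<close>, this family has a
  least element up to \<open>\<Theta>\<close>: the scale of the stratum containing \<open>y\<close>. On the lower strata this is
  conditions (i) and (ii) of the definition, and on the open stratum the family, which contains the
  sequence given by \<open>ys = y\<close>, forms a single \<open>\<Theta>\<close>-class. Since the least growth at \<open>y\<close> refers only to
  the maps \<open>f k\<close> and not to a stratification, the scales of the strata of \<open>y\<close> in two stratifications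
  are \<open>\<Theta>\<close> of each other.

  It remains to match the indices. Two scales of one stratification are never \<open>\<Theta>\<close> of each other: the
  definition characterises each lower stratum by its scale, so two strata of the same scale would
  meet (lemma \<open>scales_inequivalent\<close>). The scales are thus strictly ordered, and an induction shows
  that a scale at level \<open>i\<close> can only be equivalent to one at level \<open>j \<ge> i\<close> of the other stratification
  (lemma \<open>level_le\<close>). By symmetry the levels agree; hence both stratifications have the same strata, the
  same number of them, and equivalent scales.

  The comparison takes place in an abstract setting, where every point of \<open>U\<close> comes with a family of
  real sequences.
\<close>

section \<open>Least growth\<close>

definition least_growth :: "(nat \<Rightarrow> real) set \<Rightarrow> (nat \<Rightarrow> real) \<Rightarrow> bool" where
  "least_growth T c \<longleftrightarrow> (\<forall>a\<in>T. c \<in> O(a)) \<and> (\<exists>a\<in>T. a \<in> \<Theta>(c))"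

lemma least_growth_unique:
  assumes "least_growth T b" and "least_growth T c"
  shows "b \<in> \<Theta>(c)"
proof -
  have "v \<in> O(w)" if v: "least_growth T v" and w: "least_growth T w" for v w
  proof -
    obtain a where "a \<in> T" "a \<in> \<Theta>(w)"
      using w by (auto simp: least_growth_def)
    moreover have "v \<in> O(a)"
      using v \<open>a \<in> T\<close> by (auto simp: least_growth_def)
    ultimately show ?thesis
      using landau_o.big_trans bigthetaD1 by blast
  qed
  then show ?thesis
    using assms by (auto intro: bigthetaI simp: bigomega_iff_bigo)
qed

lemma least_growth_cong:
  assumes "b \<in> \<Theta>(c)" and "least_growth T c"
  shows "least_growth T b"
proof -
  have "b \<in> O(a)" if "c \<in> O(a)" for a
    using assms(1) that by (blast intro: bigthetaD1 landau_o.big_trans)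
  moreover have "a \<in> \<Theta>(b)" if "a \<in> \<Theta>(c)" for a
    using that assms(1) bigtheta_sym landau_theta.trans by blast
  ultimately show ?thesis
    using assms(2) unfolding least_growth_def by blast
qed

section \<open>Filtrations by growth\<close>

text \<open>The part of a dynamical stratification that matters for uniqueness. The ambient set becomes the
  last member \<open>G s\<close>, so that all strata are of the form \<open>G j - G (j - 1)\<close>. The assumption
  \<open>least_growth_imp_mem\<close> excludes \<open>j = s\<close>, because the open stratum of a dynamical stratification is not
  characterised by the least growth at its points.\<close>

locale growth_filtration =
  fixes T :: "'a \<Rightarrow> (nat \<Rightarrow> real) set" and x :: 'a and U :: "'a set"
    and s :: nat and G :: "nat \<Rightarrow> 'a set" and \<mu> :: "nat \<Rightarrow> nat \<Rightarrow> real"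
  assumes nontrivial: "1 \<le> s"
    and first: "G 0 = {x}"
    and last: "G s = U"
    and step: "j < s \<Longrightarrow> G j \<subset> G (Suc j)"
    and scale_step: "1 \<le> j \<Longrightarrow> j < s \<Longrightarrow> \<mu> j \<in> O(\<mu> (Suc j))"
    and least_growth_stratum: "1 \<le> j \<Longrightarrow> j \<le> s \<Longrightarrow> y \<in> G j - G (j - 1) \<Longrightarrow> least_growth (T y) (\<mu> j)"
    and least_growth_imp_mem: "1 \<le> j \<Longrightarrow> j < s \<Longrightarrow> y \<in> U \<Longrightarrow> least_growth (T y) (\<mu> j) \<Longrightarrow> y \<in> G j"
begin

lemma filtration_mono: "i \<le> j \<Longrightarrow> j \<le> s \<Longrightarrow> G i \<subseteq> G j"
proof (induction j rule: dec_induct)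
  case (step n)
  then show ?case
    using growth_filtration.step[OF growth_filtration_axioms, of n] by auto
qed simp

lemma scale_mono: "i \<le> j \<Longrightarrow> 1 \<le> i \<Longrightarrow> j \<le> s \<Longrightarrow> \<mu> i \<in> O(\<mu> j)"
proof (induction j rule: dec_induct)
  case (step n)
  then show ?case
    using scale_step[of n] by (auto intro: landau_o.big_trans)
qed simp

lemma base_mem: "j \<le> s \<Longrightarrow> x \<in> G j"
  using filtration_mono[of 0 j] first by auto

lemma stratum_nonempty:
  assumes "1 \<le> j" "j \<le> s"
  obtains y where "y \<in> G j - G (j - 1)"
proof -
  have "G (j - 1) \<subset> G j"
    using step[of "j - 1"] assms by simp
  then show ?thesis
    using that by blast
qed

lemma stratum_subset:
  assumes "1 \<le> j" "j \<le> s" "y \<in> G j - G (j - 1)"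
  shows "y \<in> U - {x}"
proof -
  have "x \<in> G (j - 1)"
    using assms(2) by (intro base_mem) simp
  then show ?thesis
    using filtration_mono[of j s] assms last by auto
qed

lemma stratum_exists:
  assumes "j \<le> s" "y \<in> G j" "y \<noteq> x"
  obtains i where "1 \<le> i" "i \<le> j" "y \<in> G i - G (i - 1)"
proof -
  define i where "i = (LEAST i. y \<in> G i)"
  have "y \<in> G i"
    unfolding i_def using assms(2) by (rule LeastI)
  moreover have "i \<le> j"
    unfolding i_def using assms(2) by (rule Least_le)
  moreover have "1 \<le> i"
    using \<open>y \<in> G i\<close> first assms(3) by (cases i) auto
  moreover have "y \<notin> G (i - 1)"
    using not_less_Least[of "i - 1" "\<lambda>i. y \<in> G i"] \<open>1 \<le> i\<close> by (simp add: i_def)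
  ultimately show ?thesis
    using that by blast
qed

text \<open>A point of the higher stratum would have the lower scale as its least growth, hence belong to
  the lower member of the filtration.\<close>

lemma scales_inequivalent:
  assumes "1 \<le> i" "i < j" "j \<le> s"
  shows "\<mu> i \<notin> \<Theta>(\<mu> j)"
proof
  assume eq: "\<mu> i \<in> \<Theta>(\<mu> j)"
  obtain y where y: "y \<in> G j - G (j - 1)"
    using stratum_nonempty[of j] assms by auto
  then have "least_growth (T y) (\<mu> i)"
    using least_growth_stratum[of j y] least_growth_cong[OF eq] assms by auto
  then have "y \<in> G i"
    using least_growth_imp_mem[of i y] stratum_subset[OF _ _ y] assms by auto
  moreover have "G i \<subseteq> G (j - 1)"
    using assms by (intro filtration_mono) simp_all
  ultimately show False
    using y by blast
qed

end

section \<open>Comparing two filtrations\<close>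

locale two_growth_filtrations =
  F: growth_filtration T x U s F \<mu> + H: growth_filtration T x U r H \<eta>
  for T :: "'a \<Rightarrow> (nat \<Rightarrow> real) set" and x U s F \<mu> r H \<eta>
begin

lemma swap: "two_growth_filtrations T x U r H \<eta> s F \<mu>"
  by unfold_locales

lemma scales_equivalent_at:
  assumes "1 \<le> i" "i \<le> s" "y \<in> F i - F (i - 1)"
    and "1 \<le> j" "j \<le> r" "y \<in> H j - H (j - 1)"
  shows "\<mu> i \<in> \<Theta>(\<eta> j)"
  using F.least_growth_stratum H.least_growth_stratum least_growth_unique assms by metis

lemma matching_level:
  assumes "1 \<le> i" "i \<le> s"
  obtains y j where "y \<in> F i - F (i - 1)" "1 \<le> j" "j \<le> r" "y \<in> H j - H (j - 1)"
proof -
  obtain y where y: "y \<in> F i - F (i - 1)"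
    using F.stratum_nonempty assms by blast
  have "y \<in> H r" "y \<noteq> x"
    using F.stratum_subset[OF assms y] H.last by auto
  then obtain j where "1 \<le> j" "j \<le> r" "y \<in> H j - H (j - 1)"
    using H.stratum_exists[of r y] by auto
  then show ?thesis
    using that y by blast
qed

text \<open>Equivalence of scales respects their strict order, so along \<open>1, \<dots>, i\<close> the matching levels in the
  other filtration increase at each step.\<close>

lemma level_le:
  "1 \<le> i \<Longrightarrow> i \<le> s \<Longrightarrow> 1 \<le> j \<Longrightarrow> j \<le> r \<Longrightarrow> \<mu> i \<in> \<Theta>(\<eta> j) \<Longrightarrow> i \<le> j"
proof (induction i arbitrary: j rule: nat_induct_at_least)
  case (Suc i)
  obtain y j' where y: "y \<in> F i - F (i - 1)"
    and j': "1 \<le> j'" "j' \<le> r" "y \<in> H j' - H (j' - 1)"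
    using matching_level[of i] Suc by auto
  have eq: "\<mu> i \<in> \<Theta>(\<eta> j')"
    using scales_equivalent_at[OF _ _ y j'] Suc by auto
  have "j' < j"
  proof (rule ccontr)
    assume "\<not> j' < j"
    then have "\<eta> j \<in> O(\<eta> j')"
      using H.scale_mono[of j j'] Suc j' by auto
    then have "\<mu> (Suc i) \<in> O(\<mu> i)"
      using eq Suc.prems(4) by (metis bigthetaD1 bigtheta_sym landau_o.big_trans)
    moreover have "\<mu> i \<in> O(\<mu> (Suc i))"
      using F.scale_step[of i] Suc by auto
    ultimately have "\<mu> i \<in> \<Theta>(\<mu> (Suc i))"
      by (auto intro: bigthetaI simp: bigomega_iff_bigo)
    then show False
      using F.scales_inequivalent[of i "Suc i"] Suc by auto
  qed
  moreover have "i \<le> j'"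
    using Suc.IH[of j'] Suc.prems j' eq by auto
  ultimately show ?case
    by simp
qed simp

lemma level_eq:
  assumes "1 \<le> i" "i \<le> s" "y \<in> F i - F (i - 1)"
    and "1 \<le> j" "j \<le> r" "y \<in> H j - H (j - 1)"
  shows "i = j"
proof -
  interpret swapped: two_growth_filtrations T x U r H \<eta> s F \<mu>
    by (rule swap)
  have "i \<le> j"
    using level_le scales_equivalent_at assms by blast
  moreover have "j \<le> i"
    using swapped.level_le swapped.scales_equivalent_at assms by blast
  ultimately show ?thesis
    by simp
qed

lemma length_le: "s \<le> r"
  using matching_level[of s] level_eq F.nontrivial by (metis order_refl)

lemma member_subset:
  assumes "i \<le> s"
  shows "F i \<subseteq> H i"
proof
  fix y assume y: "y \<in> F i"
  have i: "i \<le> r"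
    using length_le assms by simp
  show "y \<in> H i"
  proof (cases "y = x")
    case True
    then show ?thesis
      using H.base_mem i by simp
  next
    case False
    obtain l where l: "1 \<le> l" "l \<le> i" "y \<in> F l - F (l - 1)"
      using F.stratum_exists assms y False by blast
    have "y \<in> H r"
      using F.stratum_subset[OF l(1) _ l(3)] l(2) assms H.last by auto
    then obtain j where j: "1 \<le> j" "j \<le> r" "y \<in> H j - H (j - 1)"
      using H.stratum_exists[of r y] False by auto
    have "l = j"
      using level_eq[OF l(1) _ l(3) j] l(2) assms by auto
    then show ?thesis
      using H.filtration_mono[of j i] j l(2) i by auto
  qed
qed

lemma scales_equivalent:
  assumes "1 \<le> i" "i \<le> s"
  shows "\<eta> i \<in> \<Theta>(\<mu> i)"
proof -
  obtain y j where "y \<in> F i - F (i - 1)" "1 \<le> j" "j \<le> r" "y \<in> H j - H (j - 1)"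
    using matching_level assms by blast
  then have "\<mu> i \<in> \<Theta>(\<eta> i)"
    using scales_equivalent_at level_eq assms by metis
  then show ?thesis
    by (simp add: bigtheta_sym)
qed

end

section \<open>Dynamical stratifications\<close>

definition growth_sequences ::
    "'a topology \<Rightarrow> ('b \<Rightarrow> 'b \<Rightarrow> real) \<Rightarrow> (nat \<Rightarrow> 'a \<Rightarrow> 'b) \<Rightarrow> 'a \<Rightarrow> 'a set \<Rightarrow> 'a \<Rightarrow> (nat \<Rightarrow> real) set" where
  "growth_sequences X d f x U y =
     {(\<lambda>k. d (f k x) (f k (ys k))) |ys. sequence_tending_to X U y ys}"

lemma least_growth_growth_sequences:
  "least_growth (growth_sequences X d f x U y) c \<longleftrightarrow>
     (\<forall>ys. sequence_tending_to X U y ys \<longrightarrow> c \<in> O(\<lambda>k. d (f k x) (f k (ys k)))) \<and>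
     (\<exists>ys. sequence_tending_to X U y ys \<and> (\<lambda>k. d (f k x) (f k (ys k))) \<in> \<Theta>(c))"
  unfolding least_growth_def growth_sequences_def by blast

lemma growth_filtration_of_stratification:
  assumes U: "U \<subseteq> topspace X"
    and strat: "dynamical_stratification X A d f x U s F \<mu>"
  shows "growth_filtration (growth_sequences X d f x U) x U s (F(s := U)) \<mu>"
proof -
  have s: "1 \<le> s" and F0: "F 0 = {x}"
    and Fstep: "\<forall>j. Suc j < s \<longrightarrow> F j \<subset> F (Suc j)" and Flast: "F (s - 1) \<subset> U"
    and scale: "\<forall>j\<in>{1..<s}. \<mu> j \<in> O(\<mu> (Suc j))"
    and top: "\<forall>y\<in>U. y \<in> U - F (s - 1) \<longleftrightarrow>
        (\<forall>ys. sequence_tending_to X U y ys \<longrightarrow> (\<lambda>k. d (f k x) (f k (ys k))) \<in> \<Theta>(\<mu> s))"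
    and low: "\<forall>j\<in>{1..<s}. \<forall>y\<in>U. y \<in> F j - F (j - 1) \<longleftrightarrow>
        least_growth (growth_sequences X d f x U y) (\<mu> j)"
    using strat unfolding dynamical_stratification_def least_growth_growth_sequences
    by - (elim conjE, assumption)+
  have lower: "y \<in> F j - F (j - 1) \<longleftrightarrow> least_growth (growth_sequences X d f x U y) (\<mu> j)"
    if "1 \<le> j" "j < s" "y \<in> U" for j y
    by (rule low[rule_format]) (use that in simp_all)
  have F_sub: "F j \<subseteq> U" if "j < s" for j
  proof -
    have "j \<le> s - 1"
      using that by simp
    then have "F j \<subseteq> F (s - 1)"
    proof (induction j rule: inc_induct)
      case (step n)
      then have "F n \<subset> F (Suc n)"
        by (intro Fstep[rule_format]) simp
      then show ?case
        using step.IH by blast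
    qed simp
    then show ?thesis
      using Flast by auto
  qed
  have top_least: "least_growth (growth_sequences X d f x U y) (\<mu> s)" if y: "y \<in> U - F (s - 1)" for y
  proof -
    have const: "sequence_tending_to X U y (\<lambda>_. y)"
      using y U by (auto simp: sequence_tending_to_def)
    have all_theta: "(\<lambda>k. d (f k x) (f k (ys k))) \<in> \<Theta>(\<mu> s)"
      if "sequence_tending_to X U y ys" for ys
      using top[rule_format, of y] y that by blast
    have "\<mu> s \<in> O(\<lambda>k. d (f k x) (f k (ys k)))" if "sequence_tending_to X U y ys" for ys
      using all_theta[OF that] bigtheta_sym by (blast intro: bigthetaD1)
    then show ?thesis
      unfolding least_growth_growth_sequences
      using all_theta[OF const] const by blast
  qed
  show ?thesis
  proof
    fix j assume j: "j < s"
    show "(F(s := U)) j \<subset> (F(s := U)) (Suc j)"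
    proof (cases "Suc j = s")
      case True
      then have "F j \<subset> U"
        using Flast by auto
      then show ?thesis
        using True by auto
    next
      case False
      then show ?thesis
        using Fstep[rule_format, of j] j by auto
    qed
  next
    fix j y assume j: "1 \<le> j" "j \<le> s" and y: "y \<in> (F(s := U)) j - (F(s := U)) (j - 1)"
    show "least_growth (growth_sequences X d f x U y) (\<mu> j)"
    proof (cases "j = s")
      case True
      have "s - 1 \<noteq> s"
        using s by simp
      then show ?thesis
        using top_least y True by simp
    next
      case False
      then have "j < s" "j - 1 \<noteq> s"
        using j by simp_all
      then have "y \<in> F j - F (j - 1)" "y \<in> U"
        using y F_sub[of j] by auto
      then show ?thesis
        using lower j(1) \<open>j < s\<close> by blast
    qed
  next
    fix j y assume "1 \<le> j" "j < s" "y \<in> U" "least_growth (growth_sequences X d f x U y) (\<mu> j)"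
    then show "y \<in> (F(s := U)) j"
      using lower[of j y] by auto
  qed (use s F0 scale in auto)
qed

theorem mainTheorem5:
  fixes M :: "'a topology" and A :: "('a, 'n::finite) chart set" and g :: "('a, 'n) tensor2"
    and N :: "'b topology" and B :: "('b, 'n) chart set" and h \<rho> :: "('b, 'n) tensor2"
    and p q s r :: nat
    and f :: "nat \<Rightarrow> 'a \<Rightarrow> 'b" and f_lim :: "'a \<Rightarrow> 'b"
    and x :: 'a and U :: "'a set"
    and F H :: "nat \<Rightarrow> 'a set" and \<mu> \<eta> :: "nat \<Rightarrow> nat \<Rightarrow> real"
  assumes "smooth_manifold M A" and "connected_space M"
    and "smooth_manifold N B" and "connected_space N"
    and "pseudo_riemannian_metric A p q g" and "pseudo_riemannian_metric B p q h"
    and "p + q \<ge> 3"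
    and "riemannian_metric B \<rho>"
    and "\<And>k. conformal_immersion M A (conformal_class A p q g) N B (conformal_class B p q h) (f k)"
    and "continuous_map M N f_lim"
    and "converges_uniformly_on_compacts M (riemannian_dist N B \<rho>) f f_lim"
    and "U \<subseteq> topspace M" and "x \<in> M interior_of U"
    and "dynamical_stratification M A (riemannian_dist N B \<rho>) f x U s F \<mu>"
    and "dynamical_stratification M A (riemannian_dist N B \<rho>) f x U r H \<eta>"
  shows "r = s \<and> (\<forall>j<s. H j = F j) \<and> (\<forall>j\<in>{1..s}. \<eta> j \<in> \<Theta>(\<mu> j))"
proof -
  interpret FH: two_growth_filtrations "growth_sequences M (riemannian_dist N B \<rho>) f x U" x U
      s "F(s := U)" \<mu> r "H(r := U)" \<eta>
    using assms(12,14,15)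
    by (intro two_growth_filtrations.intro growth_filtration_of_stratification)
  interpret HF: two_growth_filtrations "growth_sequences M (riemannian_dist N B \<rho>) f x U" x U
      r "H(r := U)" \<eta> s "F(s := U)" \<mu>
    by (rule FH.swap)
  have rs: "r = s"
    using FH.length_le HF.length_le by simp
  have "H j = F j" if "j < s" for j
    using FH.member_subset[of j] HF.member_subset[of j] that rs by auto
  then show ?thesis
    using rs FH.scales_equivalent by auto
qed

end
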